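(* Let $(X,d)$ be a metric space, $f:X\to\mathbb{R}$ and $\bar x\in X$. Suppose there are an integer $m\ge 1$, an open set $U$ containing $\bar x$, and sequences $\{\Phi_i\}_{i=1}^\infty$ and $\{\Gamma_i\}_{i=1}^\infty$ of subsets of $X$ such that: (1) $\Phi_i$ and $\partial\Gamma_i$ link, for every $i$. (2) $\Gamma_i$ is homeomorphic to $\mathbb{B}^m$ for all $i$, and $\max_{x\in\partial\Gamma_i}f(x)<\inf_{x\in\Phi_i\cap U}f(x)$. (3) For any open set $V$ containing $\bar x$, there is some $I>0$ such that $\Gamma_i\subset V$ for all $i>I$. (4) $f$ is Lipschitz in $U$. Then $\bar x$ is a deformationally critical point of $f$.
   Context: $\mathbb{B}^m$ is the closed unit ball of $\mathbb{R}^m$ and $\mathbb{S}^{m-1}$ its boundary sphere. If $h:\mathbb{B}^m\to\Gamma$ is a homeomorphism onto $\Gamma\subset X$, the relative boundary of $\Gamma$ is $\partial\Gamma:=h(\mathbb{S}^{m-1})$. Linking: for $A\subset X$ and a set $B\subset X$ with relative boundary $\partial B$, we say $A$ and $\partial B$ link if (a) $A\cap\partial B=\emptyset$, and (b) for any continuous $h:X\to X$ with $h|_{\partial B}=\mathrm{id}$ one has $h(B)\cap A\ne\emptyset$. Deformationally regular/critical: a point $x\in X$ is deformationally regular for $f$ if there are numbers $\gamma,\sigma,\kappa>0$ and a continuous map $\phi:\mathbb{B}(x,\gamma)\times[0,\gamma]\to X$, where $\mathbb{B}(x,\gamma)$ is the ball of center $x$ and radius $\gamma$, such that $\phi(u,0)=u$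 for all $u\in\mathbb{B}(x,\gamma)$ and, for all $u\in\mathbb{B}(x,\gamma)$ and $t\in[0,\gamma]$, $$f(\phi(u,t))\le f(u)-\sigma t\quad\text{and}\quad d(\phi(u,t),u)\le\kappa t.$$ The point $x$ is deformationally critical if it is not deformationally regular. *)

theory Defs
  imports "HOL-Analysis.Analysis"
begin

text \<open>The relative boundary of \<open>\<Gamma> = h ` cball 0 1\<close>, for a homeomorphism \<open>h\<close> from the closed
  unit ball onto \<open>\<Gamma>\<close>. It is recorded through the parametrization \<open>h\<close>; by invariance of
  domain the resulting set depends only on \<open>\<Gamma>\<close>.\<close>

definition rel_boundary :: "(real ^ 'm \<Rightarrow> 'a) \<Rightarrow> 'a set" where
  "rel_boundary h = h ` sphere 0 1"

text \<open>\<open>links A B bd\<close>: the set \<open>A\<close> and the relative boundary \<open>bd\<close> of \<open>B\<close> link.\<close>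

definition links :: "'a::topological_space set \<Rightarrow> 'a set \<Rightarrow> 'a set \<Rightarrow> bool" where
  "links A B bd \<longleftrightarrow>
     A \<inter> bd = {} \<and>
     (\<forall>h :: 'a \<Rightarrow> 'a. continuous_on UNIV h \<and> (\<forall>x\<in>bd. h x = x) \<longrightarrow> h ` B \<inter> A \<noteq> {})"

definition deformationally_regular :: "('a::metric_space \<Rightarrow> real) \<Rightarrow> 'a \<Rightarrow> bool" where
  "deformationally_regular f x \<longleftrightarrow>
     (\<exists>\<gamma>>0. \<exists>\<sigma>>0. \<exists>\<kappa>>0. \<exists>\<phi> :: 'a \<times> real \<Rightarrow> 'a.
        continuous_on (cball x \<gamma> \<times> {0..\<gamma>}) \<phi> \<and>
        (\<forall>u\<in>cball x \<gamma>. \<phi> (u, 0) = u) \<and>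
        (\<forall>u\<in>cball x \<gamma>. \<forall>t\<in>{0..\<gamma>}.
           f (\<phi> (u, t)) \<le> f u - \<sigma> * t \<and> dist (\<phi> (u, t)) u \<le> \<kappa> * t))"

definition deformationally_critical :: "('a::metric_space \<Rightarrow> real) \<Rightarrow> 'a \<Rightarrow> bool" where
  "deformationally_critical f x \<longleftrightarrow> \<not> deformationally_regular f x"

text \<open>The strict inequality \<open>max f over A < inf f over B\<close>: the maximum is attained, and the infimum
  is taken in the extended reals, so that it is \<open>\<infinity>\<close> for empty \<open>B\<close> and \<open>-\<infinity>\<close> if \<open>f\<close> is
  unbounded below on \<open>B\<close> (the real-valued \<open>Inf\<close> is unspecified in both cases).\<close>

definition max_less_inf :: "('a \<Rightarrow> real) \<Rightarrow> 'a set \<Rightarrow> 'a set \<Rightarrow> bool" where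
  "max_less_inf f A B \<longleftrightarrow>
     (\<exists>y\<in>A. (\<forall>x\<in>A. f x \<le> f y) \<and> ereal (f y) < (INF x\<in>B. ereal (f x)))"

end

theory Submission
  imports Defs
begin

text \<open>Let \<open>\<phi>\<close> be a deformation near a regular point that decreases \<open>f\<close> at rate \<open>\<sigma>\<close>, and let
  \<open>L\<close> be a Lipschitz constant of \<open>f\<close>. On \<open>\<Gamma>\<close> the value of \<open>f\<close> exceeds its maximum over \<open>\<partial>\<Gamma>\<close> by
  at most \<open>L\<close> times the distance to \<open>\<partial>\<Gamma>\<close>, so running \<open>\<phi>\<close> for time \<open>(L / \<sigma>) * infdist u \<partial>\<Gamma>\<close>
  at \<open>u\<close> pushes \<open>\<Gamma>\<close> below \<open>inf f\<close> over \<open>\<Phi> \<inter> U\<close> while fixing \<open>\<partial>\<Gamma>\<close>. When \<open>\<Gamma>\<close> is small these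
  times are small, so \<open>\<Gamma>\<close> stays inside \<open>U\<close> and the map can be cut off to the identity far from
  the point; this contradicts linking.\<close>

text \<open>The two branches live on closed sets that meet in the sphere
  \<open>dist x u = \<gamma>\<close>, where time 0 makes both the identity. This provides the
  self-map of the whole space that linking asks for.\<close>

lemma continuous_on_local_deformation:
  fixes \<phi> :: "'a::metric_space \<times> real \<Rightarrow> 'a"
  assumes \<phi>: "continuous_on (cball x \<gamma> \<times> {0..\<gamma>}) \<phi>"
    and id: "\<And>u. u \<in> cball x \<gamma> \<Longrightarrow> \<phi> (u, 0) = u"
    and \<tau>: "continuous_on UNIV \<tau>" "range \<tau> \<subseteq> {0..\<gamma>}"
    and zero: "\<And>u. dist x u = \<gamma> \<Longrightarrow> \<tau> u = 0"
  shows "continuous_on UNIV (\<lambda>u. if dist x u \<le> \<gamma> then \<phi> (u, \<tau> u) else u)"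
proof (rule continuous_on_cases_le)
  show "continuous_on {u \<in> UNIV. dist x u \<le> \<gamma>} (\<lambda>u. \<phi> (u, \<tau> u))"
    using \<tau>
    by (intro continuous_on_compose2 [OF \<phi>] continuous_intros continuous_on_subset [OF \<tau>(1)]) auto
qed (auto intro!: continuous_intros simp: id zero)

text \<open>Compare \<open>u\<close> with each point of \<open>S\<close> and pass to the infimum of
  the distances; this divides by \<open>L\<close>, so \<open>L = 0\<close> is treated apart.\<close>

lemma lipschitz_on_le_bound_plus_infdist:
  fixes f :: "'a::metric_space \<Rightarrow> real"
  assumes lip: "L-lipschitz_on U f" and S: "S \<noteq> {}" "S \<subseteq> U"
    and le: "\<And>x. x \<in> S \<Longrightarrow> f x \<le> c" and u: "u \<in> U"
  shows "f u \<le> c + L * infdist u S"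
proof -
  have *: "f u - c \<le> L * dist u y" if "y \<in> S" for y
    using lipschitz_onD [OF lip u, of y] le [OF that] that S(2) by (auto simp: dist_real_def)
  show ?thesis
  proof (cases "L = 0")
    case True
    then show ?thesis using * S(1) by fastforce
  next
    case False
    then have "L > 0" using lipschitz_on_nonneg [OF lip] by simp
    then have "(f u - c) / L \<le> (INF y\<in>S. dist u y)"
      using * S(1) by (intro cINF_greatest) (auto simp: pos_divide_le_eq mult.commute)
    then show ?thesis
      using \<open>L > 0\<close> S(1) by (simp add: infdist_notempty pos_divide_le_eq algebra_simps)
  qed
qed

theorem theorem5p2:
  fixes f :: "'a::metric_space \<Rightarrow> real"
    and xbar :: 'a
    and U :: "'a set"
    and \<Phi> \<Gamma> :: "nat \<Rightarrow> 'a set"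
    and h :: "nat \<Rightarrow> real ^ 'm \<Rightarrow> 'a"
  assumes "open U" and "xbar \<in> U"
    and link: "\<And>i. i \<ge> 1 \<Longrightarrow> links (\<Phi> i) (\<Gamma> i) (rel_boundary (h i))"
    and homeo: "\<And>i. i \<ge> 1 \<Longrightarrow> \<exists>g. homeomorphism (cball 0 1) (\<Gamma> i) (h i) g"
    and sep: "\<And>i. i \<ge> 1 \<Longrightarrow> max_less_inf f (rel_boundary (h i)) (\<Phi> i \<inter> U)"
    and shrink: "\<And>V. open V \<Longrightarrow> xbar \<in> V \<Longrightarrow> \<exists>I>0. \<forall>i>I. \<Gamma> i \<subseteq> V"
    and lip: "\<exists>L. L-lipschitz_on U f"
  shows "deformationally_critical f xbar"
  unfolding deformationally_critical_def
proof
  assume "deformationally_regular f xbar"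
  then obtain \<gamma> \<sigma> \<kappa> \<phi> where pos: "\<gamma> > 0" "\<sigma> > 0" "\<kappa> > 0"
    and \<phi>: "continuous_on (cball xbar \<gamma> \<times> {0..\<gamma>}) \<phi>"
    and \<phi>0: "\<And>u. u \<in> cball xbar \<gamma> \<Longrightarrow> \<phi> (u, 0) = u"
    and descent: "\<And>u t. u \<in> cball xbar \<gamma> \<Longrightarrow> t \<in> {0..\<gamma>} \<Longrightarrow> f (\<phi> (u, t)) \<le> f u - \<sigma> * t"
    and speed: "\<And>u t. u \<in> cball xbar \<gamma> \<Longrightarrow> t \<in> {0..\<gamma>} \<Longrightarrow> dist (\<phi> (u, t)) u \<le> \<kappa> * t"
    unfolding deformationally_regular_def by metis
  obtain L where L: "L-lipschitz_on U f" using lip by blast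
  obtain e where e: "e > 0" "ball xbar e \<subseteq> U"
    using assms(1,2) openE by blast
  define K where "K = L / \<sigma>"
  have K: "K \<ge> 0" "\<sigma> * K = L"
    using lipschitz_on_nonneg [OF L] pos by (auto simp: K_def)
  have denom: "1 + 2 * K > 0" "1 + 2 * \<kappa> * K > 0"
    using K pos by (auto simp: add_pos_nonneg)
  \<comment> \<open>Inside \<open>ball xbar r\<close> running times are at most
    \<open>2 * K * r\<close>. The first bound keeps them below
    \<open>\<gamma> - dist xbar u\<close>, the second keeps the moved points in
    \<open>ball xbar e\<close>.\<close>
  define r where "r = min (\<gamma> / (1 + 2 * K)) (e / (1 + 2 * \<kappa> * K))"
  have "r \<le> \<gamma> / (1 + 2 * K)" "r \<le> e / (1 + 2 * \<kappa> * K)"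
    by (simp_all add: r_def)
  then have "r * (1 + 2 * K) \<le> \<gamma>" "r * (1 + 2 * \<kappa> * K) \<le> e"
    using denom by (simp_all add: pos_le_divide_eq)
  then have r: "r > 0" "r + 2 * K * r \<le> \<gamma>" "r + \<kappa> * (2 * K * r) \<le> e"
    using denom pos e by (auto simp: r_def algebra_simps)
  have Kr: "K * r \<ge> 0" "\<kappa> * (2 * K * r) \<ge> 0" using K r pos by auto
  obtain i where i: "i \<ge> 1" "\<Gamma> i \<subseteq> ball xbar r"
    using shrink [of "ball xbar r"] r(1)
    by (metis centre_in_ball le_add2 lessI open_ball Suc_eq_plus1)
  define S where "S = rel_boundary (h i)"
  obtain g where "homeomorphism (cball 0 1) (\<Gamma> i) (h i) g" using homeo i(1) by blast
  from homeomorphism_image1 [OF this] have "S \<subseteq> \<Gamma> i"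
    unfolding S_def rel_boundary_def by auto
  have \<Gamma>U: "\<Gamma> i \<subseteq> U"
    using i(2) e(2) subset_ball [of r e xbar] r(3) Kr(2) by simp
  obtain y where y: "y \<in> S" "\<And>x. x \<in> S \<Longrightarrow> f x \<le> f y"
    and y_less: "ereal (f y) < (INF x\<in>\<Phi> i \<inter> U. ereal (f x))"
    using sep [OF i(1)] unfolding max_less_inf_def S_def by blast
  \<comment> \<open>The time vanishes on \<open>S\<close>, so \<open>H\<close> fixes it, and also
    wherever \<open>dist xbar u \<ge> \<gamma>\<close>.\<close>
  define \<tau> where "\<tau> u = max 0 (min (K * infdist u S) (\<gamma> - dist xbar u))" for u
  define H where "H u = (if dist xbar u \<le> \<gamma> then \<phi> (u, \<tau> u) else u)" for u
  have \<tau>_range: "\<tau> u \<in> {0..\<gamma>}" for u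
    using pos(1) by (simp add: \<tau>_def min_le_iff_disj)
  have "continuous_on UNIV \<tau>"
    unfolding \<tau>_def by (intro continuous_intros)
  then have "continuous_on UNIV H"
    unfolding H_def using \<phi> \<phi>0 \<tau>_range
    by (intro continuous_on_local_deformation) (auto simp: \<tau>_def infdist_nonneg K)
  moreover have "H x = x" if "x \<in> S" for x
    using that \<phi>0 [of x] by (auto simp: H_def \<tau>_def)
  moreover have "H u \<notin> \<Phi> i" if u: "u \<in> \<Gamma> i" for u
  proof
    assume "H u \<in> \<Phi> i"
    have near: "dist xbar u < r" "dist xbar y < r"
      using u i(2) y(1) \<open>S \<subseteq> \<Gamma> i\<close> by auto
    have "infdist u S \<le> dist u y"
      using y(1) by (rule infdist_le)
    then have "infdist u S \<le> 2 * r"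
      using near dist_triangle3 [of u y xbar] by linarith
    then have small: "K * infdist u S \<le> 2 * K * r"
      using mult_left_mono [of _ _ K] K(1) by fastforce
    \<comment> \<open>By the choice of \<open>r\<close> the cutoff is inactive on
      \<open>\<Gamma> i\<close>.\<close>
    then have \<tau>_eq: "\<tau> u = K * infdist u S"
      using near r(2) K(1) infdist_nonneg [of u S] by (auto simp: \<tau>_def)
    have ball: "u \<in> cball xbar \<gamma>" and H_eq: "H u = \<phi> (u, \<tau> u)"
      using near r(2) Kr(1) by (auto simp: H_def)
    have "dist (H u) u \<le> \<kappa> * (2 * K * r)"
      unfolding H_eq using small pos(3)
      by (intro order_trans [OF speed [OF ball \<tau>_range] mult_left_mono]) (auto simp: \<tau>_eq)
    then have "dist xbar (H u) < e"
      using near r(3) dist_triangle2 [of xbar "H u" u] by (simp add: dist_commute)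
    then have "H u \<in> \<Phi> i \<inter> U"
      using e(2) \<open>H u \<in> \<Phi> i\<close> by auto
    then have "ereal (f y) < ereal (f (H u))"
      using y_less by (meson INF_lower less_le_trans)
    \<comment> \<open>Since \<open>\<sigma> * K = L\<close>, this drop cancels the Lipschitz gain
      exactly, leaving \<open>f (H u) \<le> f y\<close> against the strict separation.\<close>
    moreover have "f (H u) \<le> f u - L * infdist u S"
      using descent [OF ball \<tau>_range [of u]] by (simp add: H_eq \<tau>_eq flip: K(2) mult.assoc)
    moreover have "f u \<le> f y + L * infdist u S"
      using lipschitz_on_le_bound_plus_infdist [OF L] y \<open>S \<subseteq> \<Gamma> i\<close> \<Gamma>U u by blast
    ultimately show False
      by simp
  qed
  ultimately show False
    using link [OF i(1)] unfolding links_def S_def by blast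
qed

end
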